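(* Let $\pi$ be a 1-block factor code from a 1-step shift of finite type $X$ to a sofic shift $Y$. Let $y$ be a point of $Y$ and let $d$ be the minimal depth of a transition block of $\pi$ occurring in $y$ (i.e. the minimum of $|M|$ over transition blocks $(W,n,M)$ of $\pi$ such that $W$ occurs in $y$). Then $d\le|\mathscr{C}(y)|$. Moreover, if $y$ is recurrent then $d=|\mathscr{C}(y)|$.
   Context: All shift spaces are one-dimensional, two-sided, over finite alphabets; $\mathcal{A}(X)$ is the alphabet of $X$ and $\mathscr{L}(X)$ its language (set of all blocks occurring in points of $X$). $X$ is 1-step if $x\in X$ iff every $x_ix_{i+1}$ is a 2-block of $X$. A factor code is a surjective continuous shift-commuting map; it is 1-block if $\pi(x)_i=\pi_{\mathrm b}(x_i)$ for a symbol map $\pi_{\mathrm b}:\mathcal{A}(X)\to\mathcal{A}(Y)$, extended to blocks in $\mathscr{L}(X)$ symbol by symbol; $\pi_{\mathrm b}^{-1}(W)$ is the set of blocks of $X$ mapping to $W$. Transition classes: for $x,x'\in X$ write $x\to x'$ if for each integer $n$ there is $v\in X$ with $\pi(v)=\pi(x)=\pi(x')$, $v_j=x_j$ for all $j\le n$, and, for some $i\ge n$, $v_j=x'_j$ for all $j\ge i$. Write $x\sim x'$ if $x\to x'$ and $x'\to x$; this is an equivalence relation whose classes are transition classes, and $\mathscr{C}(y)=\mathscr{C}_\pi(y)$ is the set of transition classes contained in $\pi^{-1}(y)$. Transition blocks: let $W=W_0\dots W_p$ be a block of $Y$ of length $p+1$, $n$ an integer with $0<n<p$, and $M\subseteq\pi_{\mathrm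 b}^{-1}(W_n)$. A block $U\in\pi_{\mathrm b}^{-1}(W)$ is routable through $a\in M$ at time $n$ if there is $U'\in\pi_{\mathrm b}^{-1}(W)$ with $U'_0=U_0$, $U'_n=a$, $U'_p=U_p$. The triple $(W,n,M)$ is a transition block of $\pi$ if every block in $\pi_{\mathrm b}^{-1}(W)$ is routable through a symbol of $M$ at time $n$; its depth is $|M|$. A point $y$ is recurrent if each block occurring in $y$ occurs infinitely often in the positive coordinates of $y$. *)

theory Defs
  imports "HOL-Analysis.Analysis" "HOL-Library.Extended_Nat"
begin

section \<open>One-dimensional two-sided shift spaces\<close>

definition shift :: "(int \<Rightarrow> 'a) \<Rightarrow> int \<Rightarrow> 'a" where
  "shift x = (\<lambda>i. x (i + 1))"

definition alphabet :: "(int \<Rightarrow> 'a) set \<Rightarrow> 'a set" where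
  "alphabet X = (\<Union>x\<in>X. range x)"

definition sequence_topology :: "(int \<Rightarrow> 'a) topology" where
  "sequence_topology = product_topology (\<lambda>_. discrete_topology UNIV) UNIV"

text \<open>The symbol type may be infinite, but only finitely many symbols are used.  For a finite set
  \<open>A\<close> of symbols the sequences over \<open>A\<close> are closed in the sequence topology, so closedness here
  agrees with closedness in the full shift over \<open>A\<close>.\<close>

definition shift_space :: "(int \<Rightarrow> 'a) set \<Rightarrow> bool" where
  "shift_space X \<longleftrightarrow> finite (alphabet X) \<and> closedin sequence_topology X \<and> shift ` X = X"

definition occurs_at :: "'a list \<Rightarrow> (int \<Rightarrow> 'a) \<Rightarrow> int \<Rightarrow> bool" where
  "occurs_at W x i \<longleftrightarrow> (\<forall>k<length W. x (i + int k) = W ! k)"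

definition occurs_in :: "'a list \<Rightarrow> (int \<Rightarrow> 'a) \<Rightarrow> bool" where
  "occurs_in W x \<longleftrightarrow> (\<exists>i. occurs_at W x i)"

definition language :: "(int \<Rightarrow> 'a) set \<Rightarrow> 'a list set" where
  "language X = {W. \<exists>x\<in>X. occurs_in W x}"

definition sft :: "(int \<Rightarrow> 'a) set \<Rightarrow> bool" where
  "sft X \<longleftrightarrow> shift_space X \<and>
     (\<exists>A F. finite A \<and> finite F \<and> X = {x. range x \<subseteq> A \<and> (\<forall>W\<in>F. \<not> occurs_in W x)})"

definition one_step :: "(int \<Rightarrow> 'a) set \<Rightarrow> bool" where
  "one_step X \<longleftrightarrow> (\<forall>x. x \<in> X \<longleftrightarrow> (\<forall>i. [x i, x (i + 1)] \<in> language X))"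

definition recurrent :: "(int \<Rightarrow> 'a) \<Rightarrow> bool" where
  "recurrent y \<longleftrightarrow> (\<forall>W. occurs_in W y \<longrightarrow> infinite {i. 0 < i \<and> occurs_at W y i})"

section \<open>Factor codes\<close>

definition factor_code ::
    "(int \<Rightarrow> 'a) set \<Rightarrow> (int \<Rightarrow> 'b) set \<Rightarrow> ((int \<Rightarrow> 'a) \<Rightarrow> int \<Rightarrow> 'b) \<Rightarrow> bool" where
  "factor_code X Y \<pi> \<longleftrightarrow>
     shift_space X \<and> shift_space Y \<and> \<pi> ` X = Y \<and>
     continuous_map (subtopology sequence_topology X) (subtopology sequence_topology Y) \<pi> \<and>
     (\<forall>x\<in>X. \<pi> (shift x) = shift (\<pi> x))"

definition one_block ::
    "(int \<Rightarrow> 'a) set \<Rightarrow> ((int \<Rightarrow> 'a) \<Rightarrow> int \<Rightarrow> 'b) \<Rightarrow> ('a \<Rightarrow> 'b) \<Rightarrow> bool" where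
  "one_block X \<pi> \<pi>\<^sub>b \<longleftrightarrow> (\<forall>x\<in>X. \<forall>i. \<pi> x i = \<pi>\<^sub>b (x i))"

text \<open>A shift of finite type has a finite alphabet, so up to renaming its symbols are natural
  numbers; this avoids quantifying over types.\<close>

definition sofic :: "(int \<Rightarrow> 'b) set \<Rightarrow> bool" where
  "sofic Y \<longleftrightarrow> (\<exists>(Z :: (int \<Rightarrow> nat) set) \<phi>. sft Z \<and> factor_code Z Y \<phi>)"

section \<open>Transition classes\<close>

definition transition_to ::
    "(int \<Rightarrow> 'a) set \<Rightarrow> ((int \<Rightarrow> 'a) \<Rightarrow> int \<Rightarrow> 'b) \<Rightarrow> (int \<Rightarrow> 'a) \<Rightarrow> (int \<Rightarrow> 'a) \<Rightarrow> bool" where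
  "transition_to X \<pi> x x' \<longleftrightarrow>
     (\<forall>n. \<exists>v\<in>X. \<pi> v = \<pi> x \<and> \<pi> x = \<pi> x' \<and> (\<forall>j\<le>n. v j = x j) \<and> (\<exists>i\<ge>n. \<forall>j\<ge>i. v j = x' j))"

definition transition_rel ::
    "(int \<Rightarrow> 'a) set \<Rightarrow> ((int \<Rightarrow> 'a) \<Rightarrow> int \<Rightarrow> 'b) \<Rightarrow> ((int \<Rightarrow> 'a) \<times> (int \<Rightarrow> 'a)) set" where
  "transition_rel X \<pi> =
     {(x, x'). x \<in> X \<and> x' \<in> X \<and> transition_to X \<pi> x x' \<and> transition_to X \<pi> x' x}"

definition transition_classes ::
    "(int \<Rightarrow> 'a) set \<Rightarrow> ((int \<Rightarrow> 'a) \<Rightarrow> int \<Rightarrow> 'b) \<Rightarrow> (int \<Rightarrow> 'b) \<Rightarrow> (int \<Rightarrow> 'a) set set" where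
  "transition_classes X \<pi> y = {C \<in> X // transition_rel X \<pi>. C \<subseteq> {x \<in> X. \<pi> x = y}}"

section \<open>Transition blocks\<close>

definition block_preimage ::
    "(int \<Rightarrow> 'a) set \<Rightarrow> ('a \<Rightarrow> 'b) \<Rightarrow> 'b list \<Rightarrow> 'a list set" where
  "block_preimage X \<pi>\<^sub>b W = {U \<in> language X. map \<pi>\<^sub>b U = W}"

definition symbol_preimage :: "(int \<Rightarrow> 'a) set \<Rightarrow> ('a \<Rightarrow> 'b) \<Rightarrow> 'b \<Rightarrow> 'a set" where
  "symbol_preimage X \<pi>\<^sub>b b = {a \<in> alphabet X. \<pi>\<^sub>b a = b}"

definition routable ::
    "(int \<Rightarrow> 'a) set \<Rightarrow> ('a \<Rightarrow> 'b) \<Rightarrow> 'b list \<Rightarrow> nat \<Rightarrow> 'a list \<Rightarrow> 'a \<Rightarrow> bool" where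
  "routable X \<pi>\<^sub>b W n U a \<longleftrightarrow>
     (\<exists>U' \<in> block_preimage X \<pi>\<^sub>b W.
        U' ! 0 = U ! 0 \<and> U' ! n = a \<and> U' ! (length W - 1) = U ! (length W - 1))"

definition transition_block ::
    "(int \<Rightarrow> 'a) set \<Rightarrow> (int \<Rightarrow> 'b) set \<Rightarrow> ('a \<Rightarrow> 'b) \<Rightarrow> 'b list \<Rightarrow> nat \<Rightarrow> 'a set \<Rightarrow> bool" where
  "transition_block X Y \<pi>\<^sub>b W n M \<longleftrightarrow>
     W \<in> language Y \<and> 0 < n \<and> n < length W - 1 \<and> M \<subseteq> symbol_preimage X \<pi>\<^sub>b (W ! n) \<and>
     (\<forall>U \<in> block_preimage X \<pi>\<^sub>b W. \<exists>a\<in>M. routable X \<pi>\<^sub>b W n U a)"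

definition transition_depths ::
    "(int \<Rightarrow> 'a) set \<Rightarrow> (int \<Rightarrow> 'b) set \<Rightarrow> ('a \<Rightarrow> 'b) \<Rightarrow> (int \<Rightarrow> 'b) \<Rightarrow> nat set" where
  "transition_depths X Y \<pi>\<^sub>b y =
     {card M | W n M. transition_block X Y \<pi>\<^sub>b W n M \<and> occurs_in W y}"

text \<open>This is a genuine minimum: the set of depths is nonempty for every point \<open>y\<close> of \<open>Y\<close>
  (lemma \<open>transition_depths_nonempty\<close> below).\<close>

definition min_depth ::
    "(int \<Rightarrow> 'a) set \<Rightarrow> (int \<Rightarrow> 'b) set \<Rightarrow> ('a \<Rightarrow> 'b) \<Rightarrow> (int \<Rightarrow> 'b) \<Rightarrow> nat" where
  "min_depth X Y \<pi>\<^sub>b y = (LEAST d. d \<in> transition_depths X Y \<pi>\<^sub>b y)"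

lemma transition_depths_nonempty:
  assumes "y \<in> Y"
  shows "transition_depths X Y \<pi>\<^sub>b y \<noteq> {}"
proof -
  define W where "W = map y [0, 1, 2]"
  have occ: "occurs_in W y"
    unfolding occurs_in_def occurs_at_def W_def
    by (rule exI[of _ 0]) (auto simp: less_Suc_eq numeral_3_eq_3)
  have "\<exists>a \<in> symbol_preimage X \<pi>\<^sub>b (W ! 1). routable X \<pi>\<^sub>b W 1 U a"
    if U: "U \<in> block_preimage X \<pi>\<^sub>b W" for U
  proof (rule bexI)
    show "routable X \<pi>\<^sub>b W 1 U (U ! 1)"
      using U unfolding routable_def by blast
    from U have map: "map \<pi>\<^sub>b U = W" and "U \<in> language X"
      by (auto simp: block_preimage_def)
    then obtain x i where x: "x \<in> X" "occurs_at U x i"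
      by (auto simp: language_def occurs_in_def)
    have len: "1 < length U"
      using arg_cong[OF map, of length] by (simp add: W_def)
    then have "U ! 1 = x (i + 1)"
      using x(2) by (auto simp: occurs_at_def)
    moreover have "\<pi>\<^sub>b (U ! 1) = W ! 1"
      using map len by auto
    ultimately show "U ! 1 \<in> symbol_preimage X \<pi>\<^sub>b (W ! 1)"
      using x(1) by (auto simp: symbol_preimage_def alphabet_def)
  qed
  then have "transition_block X Y \<pi>\<^sub>b W 1 (symbol_preimage X \<pi>\<^sub>b (W ! 1))"
    using assms occ unfolding transition_block_def language_def by (auto simp: W_def)
  with occ show ?thesis
    unfolding transition_depths_def by blast
qed

section \<open>Cardinality\<close>

text \<open>\<^const>\<open>card\<close> sends infinite sets to 0; this version sends them to infinity.\<close>

definition ecard :: "'a set \<Rightarrow> enat" where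
  "ecard S = (if finite S then enat (card S) else \<infinity>)"

end

theory Submission
  imports Defs
begin

text \<open>
  Fix a point \<open>y\<close> and draw its fiber as a graph: the vertices at time \<open>i\<close> are the symbols over
  \<open>y i\<close>, the edges are the 2-blocks of \<open>X\<close>.  Since \<open>X\<close> is 1-step, two paths that meet at a vertex
  can be exchanged there (\<open>splice_in\<close>), and a transition block occurring in \<open>y\<close> is just a window of
  time in which every finite path can be rerouted, with the same end vertices, through a set \<open>M\<close>
  of vertices at an inner time.

  \<^bold>\<open>Depth is at most the number of classes.\<close>  Suppose there are finitely many classes, and choose a
  representative of each.  Whether a point \<open>x\<close> of the fiber can pass over to the representative of
  its class by time \<open>n\<close>, starting from time \<open>0\<close>, depends only on \<open>x 0\<close> and on the class.  These are
  finitely many data, so one time \<open>n\<close> serves the whole fiber.  From the representative one can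
  return to \<open>x\<close> after time \<open>n\<close>, so every point of the fiber can be rerouted through the set \<open>M\<close> of
  symbols which the representatives show at time \<open>n\<close> (\<open>reroutable_through_representatives\<close>).
  The window needed for this still depends on the point, and a block over \<open>y\<close> need not extend to
  a point of the fiber; compactness removes both defects (\<open>uniform_window\<close>).

  \<^bold>\<open>Equality for recurrent points.\<close>  If a transition block \<open>(W, n, M)\<close> returns infinitely often
  and there were more than \<open>card M\<close> classes, then by the pigeonhole principle two inequivalent
  points would be rerouted through the same symbol at arbitrarily late times.  Switching from one
  point to the other at these symbols makes the two points equivalent
  (\<open>transition_rel_if_common_reroutings\<close>).
\<close>

section \<open>Accumulation points of sequences over a finite alphabet\<close>

text \<open>Koenig's argument: extend a central pattern shared by infinitely many of the sequences by
  one coordinate on each side, and keep infinitely many of them by the pigeonhole principle.\<close>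

lemma finite_alphabet_accumulation:
  fixes v :: "nat \<Rightarrow> int \<Rightarrow> 'a"
  assumes "finite A" and "\<And>k. range (v k) \<subseteq> A"
  obtains z where "\<And>l. infinite {k. \<forall>i. \<bar>i\<bar> \<le> int l \<longrightarrow> v k i = z i}"
proof -
  define S where "S l g = {k. \<forall>i. \<bar>i\<bar> \<le> int l \<longrightarrow> v k i = g i}" for l and g :: "int \<Rightarrow> 'a"
  have refine: "\<exists>g'. infinite (S l g') \<and> (\<forall>i. \<bar>i\<bar> < int l \<longrightarrow> g' i = g i)"
    if inf: "infinite K" and K: "\<And>k i. k \<in> K \<Longrightarrow> \<bar>i\<bar> < int l \<Longrightarrow> v k i = g i" for l g K
  proof -
    let ?f = "\<lambda>k. (v k (int l), v k (- int l))"
    have "?f ` K \<subseteq> A \<times> A"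
      using assms(2) by auto
    then have "finite (?f ` K)"
      using \<open>finite A\<close> finite_subset by blast
    then obtain k0 where k0: "k0 \<in> K" and inf0: "infinite {k \<in> K. ?f k = ?f k0}"
      using pigeonhole_infinite[OF inf, of ?f] by blast
    have "{k \<in> K. ?f k = ?f k0} \<subseteq> S l (v k0)"
    proof
      fix k assume k: "k \<in> {k \<in> K. ?f k = ?f k0}"
      have "v k i = v k0 i" if "\<bar>i\<bar> \<le> int l" for i
      proof (cases "\<bar>i\<bar> < int l")
        case True
        then show ?thesis using K k k0 by simp
      next
        case False
        then have "i = int l \<or> i = - int l" using that by linarith
        then show ?thesis using k by auto
      qed
      then show "k \<in> S l (v k0)" by (simp add: S_def)
    qed
    then show ?thesis
      using inf0 finite_subset K[OF k0] by blast
  qed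
  have "\<exists>g. \<forall>l. infinite (S l (g l)) \<and> (\<forall>i. \<bar>i\<bar> \<le> int l \<longrightarrow> g (Suc l) i = g l i)"
  proof (rule dependent_nat_choice)
    show "\<exists>g. infinite (S 0 g)"
      using refine[of UNIV 0 undefined] by auto
  next
    fix g l assume inf: "infinite (S l g)"
    have "v k i = g i" if "k \<in> S l g" "\<bar>i\<bar> < int (Suc l)" for k i
    proof -
      have "\<bar>i\<bar> \<le> int l" using that(2) by linarith
      then show ?thesis using that(1) unfolding S_def by blast
    qed
    then obtain g' where "infinite (S (Suc l) g')" "\<forall>i. \<bar>i\<bar> < int (Suc l) \<longrightarrow> g' i = g i"
      using refine[OF inf, of "Suc l" g] by blast
    then show "\<exists>g'. infinite (S (Suc l) g') \<and> (\<forall>i. \<bar>i\<bar> \<le> int l \<longrightarrow> g' i = g i)"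
      by (intro exI[of _ g'] conjI allI impI) auto
  qed
  then obtain g where inf: "\<And>l. infinite (S l (g l))"
    and ext: "\<And>l i. \<bar>i\<bar> \<le> int l \<Longrightarrow> g (Suc l) i = g l i"
    by blast
  have stable: "g (m + l) i = g m i" if "\<bar>i\<bar> \<le> int m" for m l i
    using that by (induction l) (simp_all add: ext)
  define z where "z i = g (nat \<bar>i\<bar>) i" for i
  have "g l i = z i" if "\<bar>i\<bar> \<le> int l" for l i
    using stable[of i "nat \<bar>i\<bar>" "l - nat \<bar>i\<bar>"] that by (simp add: z_def)
  then have "S l (g l) = {k. \<forall>i. \<bar>i\<bar> \<le> int l \<longrightarrow> v k i = z i}" for l
    by (simp add: S_def)
  then have "infinite {k. \<forall>i. \<bar>i\<bar> \<le> int l \<longrightarrow> v k i = z i}" for l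
    using inf[of l] by simp
  then show thesis
    by (rule that)
qed

section \<open>Paths over a point\<close>

definition splice :: "int \<Rightarrow> (int \<Rightarrow> 'a) \<Rightarrow> (int \<Rightarrow> 'a) \<Rightarrow> int \<Rightarrow> 'a" where
  "splice c x x' = (\<lambda>i. if i \<le> c then x i else x' i)"

locale one_step_code =
  fixes X :: "(int \<Rightarrow> 'a) set"
    and \<pi> :: "(int \<Rightarrow> 'a) \<Rightarrow> int \<Rightarrow> 'b" and \<pi>\<^sub>b :: "'a \<Rightarrow> 'b"
  assumes finite_alphabet: "finite (alphabet X)"
    and one_step: "one_step X"
    and one_block: "one_block X \<pi> \<pi>\<^sub>b"
begin

definition fiber :: "(int \<Rightarrow> 'b) \<Rightarrow> (int \<Rightarrow> 'a) set" where
  "fiber y = {x \<in> X. \<pi> x = y}"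

text \<open>A finite path over \<open>y\<close> in the window from \<open>s\<close> to \<open>t\<close> is represented by any point of \<open>X\<close> that
  extends it, whatever that point maps to outside the window.\<close>

definition over :: "(int \<Rightarrow> 'b) \<Rightarrow> int \<Rightarrow> int \<Rightarrow> (int \<Rightarrow> 'a) set" where
  "over y s t = {v \<in> X. \<forall>k. s \<le> k \<and> k \<le> t \<longrightarrow> \<pi>\<^sub>b (v k) = y k}"

definition reroutable ::
    "(int \<Rightarrow> 'b) \<Rightarrow> int \<Rightarrow> int \<Rightarrow> int \<Rightarrow> 'a \<Rightarrow> (int \<Rightarrow> 'a) \<Rightarrow> bool" where
  "reroutable y s t n a v \<longleftrightarrow> (\<exists>u \<in> over y s t. u s = v s \<and> u n = a \<and> u t = v t)"

lemma in_X_iff: "x \<in> X \<longleftrightarrow> (\<forall>i. [x i, x (i + 1)] \<in> language X)"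
  using one_step by (simp add: one_step_def)

lemma translate_in: "x \<in> X \<Longrightarrow> (\<lambda>i. x (i + c)) \<in> X"
  unfolding in_X_iff by (metis add.assoc add.commute)

lemma splice_in:
  assumes "x \<in> X" "x' \<in> X" "x c = x' c"
  shows "splice c x x' \<in> X"
proof -
  have "[splice c x x' i, splice c x x' (i + 1)] \<in> language X" for i
  proof -
    consider "i < c" | "i = c" | "c < i" by linarith
    then show ?thesis
      by cases (use assms in \<open>auto simp: splice_def in_X_iff\<close>)
  qed
  then show ?thesis by (simp add: in_X_iff)
qed

lemma fiber_eq: "fiber y = {x \<in> X. \<forall>i. \<pi>\<^sub>b (x i) = y i}"
  using one_block by (auto simp: fiber_def one_block_def fun_eq_iff)

lemma fiber_over: "x \<in> fiber y \<Longrightarrow> x \<in> over y s t"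
  by (simp add: fiber_eq over_def)

lemma splice_fiber:
  "x \<in> fiber y \<Longrightarrow> x' \<in> fiber y \<Longrightarrow> x c = x' c \<Longrightarrow> splice c x x' \<in> fiber y"
  using splice_in[of x x' c] by (auto simp: fiber_eq splice_def)

lemma splice_over:
  "x \<in> over y s c \<Longrightarrow> x' \<in> over y c t \<Longrightarrow> x c = x' c \<Longrightarrow> splice c x x' \<in> over y s t"
  using splice_in[of x x' c] by (auto simp: over_def splice_def)

lemma over_mono: "v \<in> over y s t \<Longrightarrow> s \<le> s' \<Longrightarrow> t' \<le> t \<Longrightarrow> v \<in> over y s' t'"
  by (auto simp: over_def)

lemma reroutable_widen:
  assumes "reroutable y s t n a z" and "v \<in> over y s' t'" and "v s = z s" "v t = z t"
    and "s' \<le> s" "s < n" "n < t" "t \<le> t'"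
  shows "reroutable y s' t' n a v"
proof -
  obtain u where u: "u \<in> over y s t" "u s = z s" "u n = a" "u t = z t"
    using assms(1) by (auto simp: reroutable_def)
  let ?w = "splice s v (splice t u v)"
  have "splice t u v \<in> over y s t'"
    using u assms by (intro splice_over) (auto intro: over_mono)
  then have "?w \<in> over y s' t'"
    using u assms by (intro splice_over) (auto intro: over_mono simp: splice_def)
  moreover have "?w s' = v s'" "?w n = a" "?w t' = v t'"
    using u assms by (auto simp: splice_def)
  ultimately show ?thesis by (auto simp: reroutable_def)
qed

section \<open>Transition blocks as windows\<close>

definition block_of :: "nat \<Rightarrow> int \<Rightarrow> (int \<Rightarrow> 'c) \<Rightarrow> 'c list" where
  "block_of p i v = map (\<lambda>k. v (i + int k)) [0..<p]"

lemma nth_block_of [simp]: "k < p \<Longrightarrow> block_of p i v ! k = v (i + int k)"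
  and length_block_of [simp]: "length (block_of p i v) = p"
  by (simp_all add: block_of_def)

lemma block_preimage_eq:
  assumes "occurs_at W y i"
  shows "block_preimage X \<pi>\<^sub>b W = block_of (length W) i ` over y i (i + int (length W) - 1)"
proof (intro equalityI subsetI)
  fix U assume "U \<in> block_preimage X \<pi>\<^sub>b W"
  then obtain x j where x: "x \<in> X" "occurs_at U x j" and map: "map \<pi>\<^sub>b U = W"
    by (auto simp: block_preimage_def language_def occurs_in_def)
  have len: "length U = length W"
    using map by auto
  \<comment> \<open>The block may occur anywhere in \<open>x\<close>; translation moves it to the window of \<open>W\<close>.\<close>
  define v where "v = (\<lambda>k. x (k + (j - i)))"
  have v: "v \<in> X"
    using x(1) translate_in by (simp add: v_def)
  have at: "v (i + int k) = U ! k" if "k < length W" for k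
    using x(2) that len by (simp add: v_def occurs_at_def algebra_simps)
  have "\<pi>\<^sub>b (v k) = y k" if "i \<le> k" "k \<le> i + int (length W) - 1" for k
  proof -
    define m where "m = nat (k - i)"
    have m: "k = i + int m" "m < length W"
      using that by (auto simp: m_def)
    have "\<pi>\<^sub>b (U ! m) = W ! m"
      using map m(2) by auto
    then show ?thesis
      using assms m at[OF m(2)] by (simp add: occurs_at_def)
  qed
  then have "v \<in> over y i (i + int (length W) - 1)"
    using v by (simp add: over_def)
  moreover have "U = block_of (length W) i v"
    by (rule nth_equalityI) (simp_all add: len at)
  ultimately show "U \<in> block_of (length W) i ` over y i (i + int (length W) - 1)"
    by blast
next
  fix U assume "U \<in> block_of (length W) i ` over y i (i + int (length W) - 1)"
  then obtain v where v: "v \<in> over y i (i + int (length W) - 1)"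
    and U: "U = block_of (length W) i v"
    by blast
  have "occurs_at U v i"
    by (simp add: U occurs_at_def)
  then have "U \<in> language X"
    using v by (auto simp: language_def occurs_in_def over_def)
  moreover have "map \<pi>\<^sub>b U = W"
    by (rule nth_equalityI) (use v assms in \<open>auto simp: U over_def occurs_at_def\<close>)
  ultimately show "U \<in> block_preimage X \<pi>\<^sub>b W"
    by (simp add: block_preimage_def)
qed

lemma routable_block_of:
  assumes "occurs_at W y i" and "n < length W"
  shows "routable X \<pi>\<^sub>b W n (block_of (length W) i v) a \<longleftrightarrow>
    reroutable y i (i + int (length W) - 1) (i + int n) a v"
proof -
  have "0 < length W" and last: "int (length W - Suc 0) = int (length W) - 1"
    using assms(2) by auto
  then show ?thesis
    using assms(2)
    by (simp add: routable_def reroutable_def block_preimage_eq[OF assms(1)] last add_diff_eq)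
qed

lemma transition_block_iff:
  assumes "occurs_at W y i" and "y \<in> Y"
  shows "transition_block X Y \<pi>\<^sub>b W n M \<longleftrightarrow>
    0 < n \<and> n < length W - 1 \<and> M \<subseteq> symbol_preimage X \<pi>\<^sub>b (W ! n) \<and>
    (\<forall>v \<in> over y i (i + int (length W) - 1). \<exists>a\<in>M.
       reroutable y i (i + int (length W) - 1) (i + int n) a v)"
proof -
  have "W \<in> language Y"
    using assms by (auto simp: language_def occurs_in_def)
  moreover have "n < length W - 1 \<Longrightarrow> n < length W"
    by simp
  ultimately show ?thesis
    by (auto simp: transition_block_def block_preimage_eq[OF assms(1)] routable_block_of[OF assms(1)])
qed

lemma card_in_transition_depths:
  assumes "y \<in> Y" and "s < n" "n < t" and "M \<subseteq> symbol_preimage X \<pi>\<^sub>b (y n)"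
    and "\<And>v. v \<in> over y s t \<Longrightarrow> \<exists>a\<in>M. reroutable y s t n a v"
  shows "card M \<in> transition_depths X Y \<pi>\<^sub>b y"
proof -
  define W where "W = block_of (nat (t - s + 1)) s y"
  have occ: "occurs_at W y s"
    by (simp add: W_def occurs_at_def)
  have t: "s + int (length W) - 1 = t" and n: "s + int (nat (n - s)) = n"
    and pos: "0 < nat (n - s)" "nat (n - s) < length W - 1"
    using assms(2,3) by (auto simp: W_def)
  have Wn: "W ! nat (n - s) = y n"
    unfolding W_def using pos(2) n by (subst nth_block_of) (simp_all only: W_def length_block_of)
  have "transition_block X Y \<pi>\<^sub>b W (nat (n - s)) M"
    unfolding transition_block_iff[OF occ \<open>y \<in> Y\<close>] t n Wn
    using pos assms(4,5) by blast
  then show ?thesis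
    using occ by (auto simp: transition_depths_def occurs_in_def)
qed

section \<open>Transition classes\<close>

lemma transition_to_iff:
  assumes "x \<in> fiber y"
  shows "transition_to X \<pi> x x' \<longleftrightarrow>
    \<pi> x' = y \<and> (\<forall>n. \<exists>v\<in>fiber y. (\<forall>j\<le>n. v j = x j) \<and> (\<exists>i\<ge>n. \<forall>j\<ge>i. v j = x' j))"
proof -
  have "\<pi> x = y"
    using assms by (simp add: fiber_def)
  then show ?thesis
    by (cases "\<pi> x' = y") (simp_all add: transition_to_def fiber_def Bex_def conj_assoc)
qed

lemma transition_to_path:
  assumes "x \<in> fiber y" and "transition_to X \<pi> x x'"
  obtains v i where "v \<in> fiber y" "\<forall>j\<le>n. v j = x j" "n \<le> i" "\<forall>j\<ge>i. v j = x' j"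
proof -
  have "\<forall>n. \<exists>v\<in>fiber y. (\<forall>j\<le>n. v j = x j) \<and> (\<exists>i\<ge>n. \<forall>j\<ge>i. v j = x' j)"
    using assms(2) unfolding transition_to_iff[OF assms(1)] by (rule conjunct2)
  then obtain v where v: "v \<in> fiber y" "(\<forall>j\<le>n. v j = x j) \<and> (\<exists>i\<ge>n. \<forall>j\<ge>i. v j = x' j)"
    by (elim allE bexE)
  then obtain i where "n \<le> i" "\<forall>j\<ge>i. v j = x' j"
    by (elim conjE exE) blast
  then show thesis
    by (rule that[OF v(1) conjunct1[OF v(2)]])
qed

lemma transition_to_trans:
  assumes "x \<in> X" "x' \<in> X" and "transition_to X \<pi> x x'" "transition_to X \<pi> x' x''"
  shows "transition_to X \<pi> x x''"
proof -
  let ?y = "\<pi> x"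
  have x: "x \<in> fiber ?y" and x': "x' \<in> fiber ?y"
    using assms by (auto simp: fiber_def transition_to_def)
  have "\<exists>v\<in>fiber ?y. (\<forall>j\<le>n. v j = x j) \<and> (\<exists>i\<ge>n. \<forall>j\<ge>i. v j = x'' j)" for n
  proof -
    obtain v i where v: "v \<in> fiber ?y" "\<forall>j\<le>n. v j = x j" "n \<le> i" "\<forall>j\<ge>i. v j = x' j"
      by (rule transition_to_path[OF x assms(3)])
    obtain w k where w: "w \<in> fiber ?y" "\<forall>j\<le>i. w j = x' j" "i \<le> k" "\<forall>j\<ge>k. w j = x'' j"
      by (rule transition_to_path[OF x' assms(4)])
    have "splice i v w \<in> fiber ?y"
      using v w by (intro splice_fiber) auto
    moreover have "\<forall>j\<le>n. splice i v w j = x j" "\<forall>j\<ge>k+1. splice i v w j = x'' j" "k + 1 \<ge> n"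
      using v w by (auto simp: splice_def)
    ultimately show ?thesis by blast
  qed
  moreover have "\<pi> x'' = ?y"
    using assms(4) unfolding transition_to_iff[OF x'] by (rule conjunct1)
  ultimately show ?thesis
    unfolding transition_to_iff[OF x] by (intro conjI allI)
qed

lemma equiv_transition_rel: "equiv X (transition_rel X \<pi>)"
proof (rule equivI)
  show "transition_rel X \<pi> \<subseteq> X \<times> X"
    by (auto simp: transition_rel_def)
  show "refl_on X (transition_rel X \<pi>)"
    by (auto simp: refl_on_def transition_rel_def transition_to_def)
  show "sym (transition_rel X \<pi>)"
    by (auto simp: sym_def transition_rel_def)
  show "trans (transition_rel X \<pi>)"
  proof (rule transI)
    fix x x' x''
    assume "(x, x') \<in> transition_rel X \<pi>" "(x', x'') \<in> transition_rel X \<pi>"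
    then show "(x, x'') \<in> transition_rel X \<pi>"
      using transition_to_trans[of x x' x''] transition_to_trans[of x'' x' x]
      by (simp add: transition_rel_def)
  qed
qed

lemma transition_class_in:
  assumes "x \<in> fiber y"
  shows "transition_rel X \<pi> `` {x} \<in> transition_classes X \<pi> y"
proof -
  have "x' \<in> X \<and> \<pi> x' = y" if "(x, x') \<in> transition_rel X \<pi>" for x'
    using that transition_to_iff[OF assms] by (simp add: transition_rel_def)
  moreover have "transition_rel X \<pi> `` {x} \<in> X // transition_rel X \<pi>"
    using assms by (intro quotientI) (simp add: fiber_def)
  ultimately show ?thesis
    by (auto simp: transition_classes_def)
qed

lemma transition_class_witness:
  assumes "C \<in> transition_classes X \<pi> y"
  obtains x where "x \<in> fiber y" "C = transition_rel X \<pi> `` {x}"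
proof -
  obtain x where x: "x \<in> X" "C = transition_rel X \<pi> `` {x}"
    using assms by (auto simp: transition_classes_def elim: quotientE)
  then have "x \<in> C"
    using equiv_class_self[OF equiv_transition_rel] by simp
  then show thesis
    using that[of x] x assms by (auto simp: transition_classes_def fiber_def)
qed

section \<open>The depth is at most the number of classes\<close>

text \<open>Otherwise each window around \<open>n\<close> contains a path that cannot be rerouted through \<open>M\<close>.  An
  accumulation point of such paths lies in the fiber of \<open>y\<close>, and a rerouting of this point involves only finitely many
  coordinates, so it also reroutes some of the paths.\<close>

lemma uniform_window:
  assumes "\<And>z. z \<in> fiber y \<Longrightarrow> \<exists>s<n. \<exists>t>n. \<exists>a\<in>M. reroutable y s t n a z"
  shows "\<exists>s<n. \<exists>t>n. \<forall>v\<in>over y s t. \<exists>a\<in>M. reroutable y s t n a v"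
proof (rule ccontr)
  assume contra: "\<not> ?thesis"
  have "\<exists>v\<in>over y (n - 1 - int k) (n + 1 + int k).
          \<not> (\<exists>a\<in>M. reroutable y (n - 1 - int k) (n + 1 + int k) n a v)" for k
    using contra by force
  then obtain v where over: "\<And>k. v k \<in> over y (n - 1 - int k) (n + 1 + int k)"
    and avoids: "\<And>k a. a \<in> M \<Longrightarrow> \<not> reroutable y (n - 1 - int k) (n + 1 + int k) n a (v k)"
    by metis
  have "range (v k) \<subseteq> alphabet X" for k
    using over[of k] by (auto simp: alphabet_def over_def)
  then obtain z where z: "\<And>l. infinite {k. \<forall>i. \<bar>i\<bar> \<le> int l \<longrightarrow> v k i = z i}"
    using finite_alphabet_accumulation[OF finite_alphabet, of v] by blast
  have close: "\<exists>k. l \<le> k \<and> (\<forall>i. \<bar>i\<bar> \<le> int l \<longrightarrow> v k i = z i)" for l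
    using z[of l] unfolding infinite_nat_iff_unbounded_le by blast
  have "[z i, z (i + 1)] \<in> language X \<and> \<pi>\<^sub>b (z i) = y i" for i
  proof -
    obtain k where k: "nat (\<bar>i\<bar> + \<bar>n\<bar> + 1) \<le> k"
      and eq: "\<forall>j. \<bar>j\<bar> \<le> int (nat (\<bar>i\<bar> + \<bar>n\<bar> + 1)) \<longrightarrow> v k j = z j"
      using close by blast
    have "v k i = z i" "v k (i + 1) = z (i + 1)"
      using eq by auto
    moreover have "[v k i, v k (i + 1)] \<in> language X"
      using over[of k] by (simp add: over_def in_X_iff)
    moreover have "\<pi>\<^sub>b (v k i) = y i"
      using over[of k] k unfolding over_def by (smt (verit) mem_Collect_eq nat_le_iff)
    ultimately show ?thesis by simp
  qed
  then have "z \<in> fiber y"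
    by (simp add: fiber_eq in_X_iff)
  then obtain s t a where st: "s < n" "n < t" "a \<in> M" and r: "reroutable y s t n a z"
    using assms by blast
  obtain k where k: "nat (\<bar>s\<bar> + \<bar>t\<bar> + \<bar>n\<bar>) \<le> k"
    and eq: "\<forall>j. \<bar>j\<bar> \<le> int (nat (\<bar>s\<bar> + \<bar>t\<bar> + \<bar>n\<bar>)) \<longrightarrow> v k j = z j"
    using close by blast
  have "reroutable y (n - 1 - int k) (n + 1 + int k) n a (v k)"
    by (rule reroutable_widen[OF r over]) (use st k eq in auto)
  then show False
    using avoids st by blast
qed

text \<open>The points of the fiber may be infinitely many, but a time by which \<open>x\<close> can have joined the
  representative of its class works for all points of the same class with the same symbol at time
  \<open>0\<close>.  There are finitely many such pairs of a symbol and a class, hence a common time.\<close>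

lemma reroutable_through_representatives:
  assumes fin: "finite (transition_classes X \<pi> y)"
    and rep: "\<And>C. C \<in> transition_classes X \<pi> y \<Longrightarrow> r C \<in> C"
  shows "\<exists>n>0. \<forall>x\<in>fiber y. \<exists>t>n. \<exists>C\<in>transition_classes X \<pi> y. reroutable y 0 t n (r C n) x"
proof -
  define cls where "cls x = transition_rel X \<pi> `` {x}" for x
  define joins where
    "joins N p \<longleftrightarrow> (\<exists>v\<in>fiber y. v 0 = fst p \<and> (\<forall>j\<ge>N. v j = r (snd p) j))" for N p
  have cls: "cls x \<in> transition_classes X \<pi> y" if "x \<in> fiber y" for x
    using that transition_class_in by (simp add: cls_def)
  have to: "transition_to X \<pi> x (r (cls x))" "transition_to X \<pi> (r (cls x)) x"
      "r (cls x) \<in> fiber y" if x: "x \<in> fiber y" for x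
  proof -
    have "(x, r (cls x)) \<in> transition_rel X \<pi>"
      using rep[OF cls[OF x]] by (simp add: cls_def)
    then show "transition_to X \<pi> x (r (cls x))" "transition_to X \<pi> (r (cls x)) x"
      "r (cls x) \<in> fiber y"
      using transition_to_iff[OF x] by (simp_all add: transition_rel_def fiber_def)
  qed
  let ?P = "(\<lambda>x. (x 0, cls x)) ` fiber y"
  have "?P \<subseteq> alphabet X \<times> transition_classes X \<pi> y"
    using cls by (auto simp: alphabet_def fiber_def)
  then have "finite ?P"
    using finite_alphabet fin finite_subset by blast
  moreover have "eventually (\<lambda>N. joins N p) at_top" if "p \<in> ?P" for p
  proof -
    obtain x where x: "x \<in> fiber y" "p = (x 0, cls x)"
      using \<open>p \<in> ?P\<close> by blast
    obtain v i where v: "v \<in> fiber y" "\<forall>j\<le>0. v j = x j" "0 \<le> i" "\<forall>j\<ge>i. v j = r (cls x) j"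
      by (rule transition_to_path[OF x(1) to(1)[OF x(1)]])
    have "joins N p" if "i \<le> N" for N
      unfolding joins_def using v x that by (intro bexI[of _ v]) auto
    then show ?thesis
      by (auto simp: eventually_at_top_linorder)
  qed
  ultimately have "eventually (\<lambda>N. \<forall>p\<in>?P. joins N p) at_top"
    by (intro eventually_ball_finite) auto
  then have "eventually (\<lambda>N. 0 < N \<and> (\<forall>p\<in>?P. joins N p)) at_top"
    using eventually_gt_at_top by (rule eventually_conj[rotated])
  then obtain n :: int where n: "0 < n" "\<And>p. p \<in> ?P \<Longrightarrow> joins n p"
    by (metis (no_types, lifting) eventually_at_top_linorder order_refl)
  have "\<exists>t>n. reroutable y 0 t n (r (cls x) n) x" if x: "x \<in> fiber y" for x
  proof -
    obtain v where v: "v \<in> fiber y" "v 0 = x 0" "\<forall>j\<ge>n. v j = r (cls x) j"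
      using n(2)[of "(x 0, cls x)"] x by (auto simp: joins_def)
    obtain w i where w: "w \<in> fiber y" "\<forall>j\<le>n. w j = r (cls x) j" "n \<le> i" "\<forall>j\<ge>i. w j = x j"
      by (rule transition_to_path[OF to(3)[OF x] to(2)[OF x]])
    \<comment> \<open>The window must end after \<open>n\<close>, while \<open>i = n\<close> is possible; hence \<open>i + 1\<close>.\<close>
    have "splice n v w \<in> over y 0 (i + 1)"
      using v w by (intro fiber_over splice_fiber) auto
    moreover have "splice n v w 0 = x 0" "splice n v w n = r (cls x) n"
      "splice n v w (i + 1) = x (i + 1)"
      using v w n(1) by (auto simp: splice_def)
    ultimately have "reroutable y 0 (i + 1) n (r (cls x) n) x"
      by (auto simp: reroutable_def)
    then show ?thesis
      using w(3) by (intro exI[of _ "i + 1"]) auto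
  qed
  then show ?thesis
    using n(1) cls by blast
qed

lemma min_depth_le_card:
  assumes "y \<in> Y" and fin: "finite (transition_classes X \<pi> y)"
  shows "min_depth X Y \<pi>\<^sub>b y \<le> card (transition_classes X \<pi> y)"
proof -
  let ?\<C> = "transition_classes X \<pi> y"
  have "\<exists>c. c \<in> C" if "C \<in> ?\<C>" for C
    using that equiv_class_self[OF equiv_transition_rel]
    by (metis (no_types, lifting) transition_class_witness fiber_def mem_Collect_eq)
  then obtain r where rep: "\<And>C. C \<in> ?\<C> \<Longrightarrow> r C \<in> C"
    by metis
  then obtain n where n: "0 < n"
      "\<forall>x\<in>fiber y. \<exists>t>n. \<exists>C\<in>?\<C>. reroutable y 0 t n (r C n) x"
    using reroutable_through_representatives[OF fin] by blast
  define M where "M = (\<lambda>C. r C n) ` ?\<C>"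
  obtain s t where st: "s < n" "n < t" "\<forall>v\<in>over y s t. \<exists>a\<in>M. reroutable y s t n a v"
  proof -
    have "\<exists>s<n. \<exists>t>n. \<exists>a\<in>M. reroutable y s t n a z" if "z \<in> fiber y" for z
      using n that by (auto simp: M_def)
    then show thesis
      using uniform_window[of y n M] that by blast
  qed
  have "r C \<in> fiber y" if "C \<in> ?\<C>" for C
    using that rep[OF that] by (auto simp: transition_classes_def fiber_def)
  then have "M \<subseteq> symbol_preimage X \<pi>\<^sub>b (y n)"
    by (force simp: M_def symbol_preimage_def alphabet_def fiber_eq)
  then have "card M \<in> transition_depths X Y \<pi>\<^sub>b y"
    using card_in_transition_depths[OF \<open>y \<in> Y\<close>] st by blast
  then have "min_depth X Y \<pi>\<^sub>b y \<le> card M"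
    unfolding min_depth_def by (rule Least_le)
  also have "\<dots> \<le> card ?\<C>"
    unfolding M_def by (rule card_image_le[OF fin])
  finally show ?thesis .
qed

section \<open>Recurrent points\<close>

lemma transition_to_if_common_reroutings:
  assumes x: "x \<in> fiber y" and x': "x' \<in> fiber y"
    and common: "\<And>N. \<exists>s\<ge>N. \<exists>n>s. \<exists>t>n. \<exists>a. reroutable y s t n a x \<and> reroutable y s t n a x'"
  shows "transition_to X \<pi> x x'"
proof -
  have "\<exists>v\<in>fiber y. (\<forall>j\<le>N. v j = x j) \<and> (\<exists>i\<ge>N. \<forall>j\<ge>i. v j = x' j)" for N
  proof -
    obtain s n t a where st: "N \<le> s" "s < n" "n < t"
      and r: "reroutable y s t n a x" and r': "reroutable y s t n a x'"
      using common[of N] by blast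
    obtain u where u: "u \<in> over y s t" "u s = x s" "u n = a"
      using r by (auto simp: reroutable_def)
    obtain u' where u': "u' \<in> over y s t" "u' n = a" "u' t = x' t"
      using r' by (auto simp: reroutable_def)
    \<comment> \<open>Switch from \<open>x\<close> to \<open>x'\<close> at the common symbol \<open>a\<close>.\<close>
    define w where "w = splice s x (splice n u (splice t u' x'))"
    have "splice t u' x' \<in> X"
      using u' x' by (auto simp: over_def fiber_def intro: splice_in)
    then have "splice n u (splice t u' x') \<in> X"
      by (rule splice_in[rotated]) (use u u' st in \<open>auto simp: over_def splice_def\<close>)
    then have "w \<in> X"
      unfolding w_def
      by (rule splice_in[rotated]) (use u x st in \<open>auto simp: fiber_def splice_def\<close>)
    moreover have "\<pi>\<^sub>b (w j) = y j" for j
      using u u' x x' st by (auto simp: w_def splice_def over_def fiber_eq)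
    ultimately have "w \<in> fiber y"
      by (simp add: fiber_eq)
    moreover have "\<forall>j\<le>N. w j = x j" "\<forall>j\<ge>t + 1. w j = x' j" "t + 1 \<ge> N"
      using st by (auto simp: w_def splice_def)
    ultimately show ?thesis by blast
  qed
  moreover have "\<pi> x' = y"
    using x' by (simp add: fiber_def)
  ultimately show ?thesis
    unfolding transition_to_iff[OF x] by (intro conjI allI)
qed

lemma transition_rel_if_common_reroutings:
  assumes "x \<in> fiber y" "x' \<in> fiber y"
    and "\<And>N. \<exists>s\<ge>N. \<exists>n>s. \<exists>t>n. \<exists>a. reroutable y s t n a x \<and> reroutable y s t n a x'"
  shows "(x, x') \<in> transition_rel X \<pi>"
proof -
  have "transition_to X \<pi> x x'"
    using assms by (rule transition_to_if_common_reroutings)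
  moreover have "transition_to X \<pi> x' x"
  proof (rule transition_to_if_common_reroutings[OF assms(2,1)])
    show "\<exists>s\<ge>N. \<exists>n>s. \<exists>t>n. \<exists>a. reroutable y s t n a x' \<and> reroutable y s t n a x" for N
      using assms(3)[of N] by blast
  qed
  ultimately show ?thesis
    using assms(1,2) by (simp add: transition_rel_def fiber_def)
qed

text \<open>For two points of different classes there is a time after which no symbol serves to reroute both
  of them.  For finitely many classes this happens for all pairs at once, so at a late occurrence
  of \<open>W\<close> the classes inject into \<open>M\<close>.  Working with finite sets of classes first is what
  shows that there are finitely many.\<close>

lemma card_classes_le_depth:
  assumes "y \<in> Y" and "recurrent y" and W: "occurs_in W y"
    and tb: "transition_block X Y \<pi>\<^sub>b W n M"
    and S: "S \<subseteq> transition_classes X \<pi> y" "finite S"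
  shows "card S \<le> card M"
proof -
  define end_of where "end_of s = s + int (length W) - 1" for s
  have n: "0 < n" "n < length W - 1" and "M \<subseteq> alphabet X"
    using tb by (auto simp: transition_block_def symbol_preimage_def)
  then have M: "finite M"
    using finite_alphabet finite_subset by blast
  have "\<exists>x. x \<in> fiber y \<and> C = transition_rel X \<pi> `` {x}" if "C \<in> S" for C
    using that S transition_class_witness by blast
  then obtain r where r: "\<And>C. C \<in> S \<Longrightarrow> r C \<in> fiber y"
      "\<And>C. C \<in> S \<Longrightarrow> C = transition_rel X \<pi> `` {r C}"
    by metis
  have "eventually (\<lambda>s. \<not> (\<exists>a. reroutable y s (end_of s) (s + int n) a (r C) \<and>
      reroutable y s (end_of s) (s + int n) a (r C'))) at_top"
    if "C \<in> S" "C' \<in> S" "C \<noteq> C'" for C C'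
  proof (rule ccontr)
    assume contra: "\<not> ?thesis"
    have "(r C, r C') \<in> transition_rel X \<pi>"
    proof (rule transition_rel_if_common_reroutings)
      fix N
      obtain s a where "s \<ge> N" "reroutable y s (end_of s) (s + int n) a (r C)"
          "reroutable y s (end_of s) (s + int n) a (r C')"
        using contra unfolding eventually_at_top_linorder by blast
      moreover have "s < s + int n" "s + int n < end_of s"
        using n by (auto simp: end_of_def)
      ultimately show "\<exists>s\<ge>N. \<exists>n>s. \<exists>t>n. \<exists>a. reroutable y s t n a (r C) \<and> reroutable y s t n a (r C')"
        by blast
    qed (use r that in auto)
    then show False
      using that r(2) equiv_class_eq[OF equiv_transition_rel] by metis
  qed
  then have "eventually (\<lambda>s. \<forall>(C, C') \<in> {(C, C') \<in> S \<times> S. C \<noteq> C'}.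
      \<not> (\<exists>a. reroutable y s (end_of s) (s + int n) a (r C) \<and>
        reroutable y s (end_of s) (s + int n) a (r C'))) at_top"
    using \<open>finite S\<close>
    by (intro eventually_ball_finite) (auto intro: finite_subset[of _ "S \<times> S"])
  then obtain N where N: "\<And>s C C' a. N \<le> s \<Longrightarrow> C \<in> S \<Longrightarrow> C' \<in> S \<Longrightarrow> C \<noteq> C' \<Longrightarrow>
      reroutable y s (end_of s) (s + int n) a (r C) \<Longrightarrow>
      \<not> reroutable y s (end_of s) (s + int n) a (r C')"
    unfolding eventually_at_top_linorder by fast
  obtain s where s: "N \<le> s" "occurs_at W y s"
  proof -
    have "infinite {s. 0 < s \<and> occurs_at W y s}"
      using \<open>recurrent y\<close> W by (simp add: recurrent_def)
    then have "\<not> {s. 0 < s \<and> occurs_at W y s} \<subseteq> {0..N}"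
      using finite_subset[OF _ finite_atLeastAtMost_int] by blast
    then obtain s where "occurs_at W y s" "0 < s" "s \<notin> {0..N}"
      by blast
    then show thesis
      by (intro that[of s]) auto
  qed
  have "\<exists>a\<in>M. reroutable y s (end_of s) (s + int n) a (r C)" if "C \<in> S" for C
    using tb fiber_over[OF r(1)[OF that]]
    unfolding transition_block_iff[OF s(2) \<open>y \<in> Y\<close>] end_of_def by blast
  then obtain f where f: "\<And>C. C \<in> S \<Longrightarrow> f C \<in> M"
      "\<And>C. C \<in> S \<Longrightarrow> reroutable y s (end_of s) (s + int n) (f C) (r C)"
    by metis
  have "inj_on f S"
  proof (rule inj_onI, rule ccontr)
    fix C C' assume C: "C \<in> S" "C' \<in> S" "f C = f C'" "C \<noteq> C'"
    then show False
      using N[OF s(1) C(1,2,4) f(2)[OF C(1)]] f(2)[OF C(2)] by simp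
  qed
  then show ?thesis
    using f(1) M by (intro card_inj_on_le) auto
qed

lemma recurrent_classes_le_min_depth:
  assumes "y \<in> Y" and "recurrent y"
  shows "finite (transition_classes X \<pi> y) \<and>
    card (transition_classes X \<pi> y) \<le> min_depth X Y \<pi>\<^sub>b y"
proof -
  have "min_depth X Y \<pi>\<^sub>b y \<in> transition_depths X Y \<pi>\<^sub>b y"
    unfolding min_depth_def
    using transition_depths_nonempty[OF \<open>y \<in> Y\<close>] by (metis LeastI_ex ex_in_conv)
  then obtain W n M where "transition_block X Y \<pi>\<^sub>b W n M" "occurs_in W y"
    "card M = min_depth X Y \<pi>\<^sub>b y"
    by (auto simp: transition_depths_def)
  then show ?thesis
    using card_classes_le_depth[OF assms] by (intro finite_if_finite_subsets_card_bdd) metis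
qed

end

section \<open>Minimal depth and the number of transition classes\<close>

theorem theorem4p22:
  fixes X :: "(int \<Rightarrow> 'a) set" and Y :: "(int \<Rightarrow> 'b) set"
    and \<pi> :: "(int \<Rightarrow> 'a) \<Rightarrow> int \<Rightarrow> 'b" and \<pi>\<^sub>b :: "'a \<Rightarrow> 'b"
    and y :: "int \<Rightarrow> 'b" and d :: nat
  assumes "sft X" and "one_step X" and "sofic Y"
    and "factor_code X Y \<pi>" and "one_block X \<pi> \<pi>\<^sub>b"
    and "y \<in> Y"
    and "d = min_depth X Y \<pi>\<^sub>b y"
  shows "enat d \<le> ecard (transition_classes X \<pi> y) \<and>
         (recurrent y \<longrightarrow> enat d = ecard (transition_classes X \<pi> y))"
proof -
  interpret one_step_code X \<pi> \<pi>\<^sub>b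
  proof
    show "finite (alphabet X)"
      using \<open>factor_code X Y \<pi>\<close> by (simp add: factor_code_def shift_space_def)
  qed (fact assms)+
  have le: "d \<le> card (transition_classes X \<pi> y)" if "finite (transition_classes X \<pi> y)"
    using min_depth_le_card[OF \<open>y \<in> Y\<close> that] assms(7) by simp
  moreover have "finite (transition_classes X \<pi> y) \<and> card (transition_classes X \<pi> y) \<le> d"
    if "recurrent y"
    using recurrent_classes_le_min_depth[OF \<open>y \<in> Y\<close> that] assms(7) by simp
  ultimately show ?thesis
    by (auto simp: ecard_def)
qed

end
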